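(* Let $q$ be a positive integer. The number $\Lambda_{2,q}$ of number-conserving CA rules with two inputs and $q$ states is $$\Lambda_{2,q}=\begin{cases}\displaystyle 2\sum_{j=1}^{q/2}(j!)^2\,j^{\,q-2j} & \text{if } q \text{ is even},\\[2ex] \displaystyle 2\sum_{j=1}^{(q-1)/2}(j!)^2\,j^{\,q-2j}+\left(\frac{q+1}{2}\right)!\left(\frac{q-1}{2}\right)! & \text{if } q \text{ is odd}.\end{cases}$$
   Context: For a positive integer $q$, let $\mathcal{Q}=\{0,1,\ldots,q-1\}$. A CA (cellular automaton) rule with two inputs and $q$ states is a function $f:\mathcal{Q}^2\to\mathcal{Q}$. The rule $f$ is number-conserving if for every integer $L\ge 2$ and every cyclic configuration $(x_1,x_2,\ldots,x_L)\in\mathcal{Q}^L$, $$f(x_1,x_2)+f(x_2,x_3)+\cdots+f(x_{L-1},x_L)+f(x_L,x_1)=x_1+x_2+\cdots+x_L,$$ where sums are ordinary sums of integers. $\Lambda_{2,q}$ denotes the number of functions $f:\mathcal{Q}^2\to\mathcal{Q}$ that are number-conserving. An empty sum is $0$. *)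

theory Defs
  imports Main "HOL-Library.FuncSet"
begin

definition states :: "nat \<Rightarrow> nat set" where
  "states q = {0..<q}"

text \<open>
  The rules are extensional functions (\<open>undefined\<close> outside the square of the state set), so that
  counting them counts each function from the square to the state set exactly once.
\<close>

definition rules2 :: "nat \<Rightarrow> (nat \<times> nat \<Rightarrow> nat) set" where
  "rules2 q = (states q \<times> states q) \<rightarrow>\<^sub>E states q"

text \<open>
  The cells of a cyclic configuration of length \<open>L\<close> are indexed by \<open>0, \<dots>, L - 1\<close>; the values of
  \<open>x\<close> at other indices are irrelevant.
\<close>

definition number_conserving :: "nat \<Rightarrow> (nat \<times> nat \<Rightarrow> nat) \<Rightarrow> bool" where
  "number_conserving q f \<longleftrightarrow>
     (\<forall>L::nat. L \<ge> 2 \<longrightarrow> (\<forall>x \<in> {0..<L} \<rightarrow> states q.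
        (\<Sum>i = 0..<L. f (x i, x ((i + 1) mod L))) = (\<Sum>i = 0..<L. x i)))"

definition Lambda2 :: "nat \<Rightarrow> nat" where
  "Lambda2 q = card {f \<in> rules2 q. number_conserving q f}"

end

theory Submission
  imports Defs
begin

text \<open>
  Conservation on cycles of length two and three with a cell in state \<open>0\<close> forces
  \<open>f (x, y) = h x + (y - h y)\<close> with \<open>h x = f (x, 0)\<close>, and conversely every such \<open>f\<close> is conserving
  because the sum telescopes. That \<open>f\<close> takes values in \<open>{0..<q}\<close> means \<open>0 \<le> h y \<le> y\<close> together with
  \<open>max h + max (y - h y) \<le> q - 1\<close>. Put \<open>m = h (q - 1)\<close>. Then the last condition says
  \<open>y - (q - 1 - m) \<le> h y \<le> m\<close> for all \<open>y\<close>, so for fixed \<open>m\<close> the values of \<open>h\<close> are chosen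
  independently, and with \<open>s = min m (q - 1 - m) + 1\<close> the numbers of choices are
  \<open>1, \<dots>, s - 1, s, \<dots>, s, s - 1, \<dots>, 1\<close>.
\<close>

section \<open>Cyclic sums and configurations of length two and three\<close>

lemma sum_cyclic_shift:
  fixes g :: "nat \<Rightarrow> 'a::comm_monoid_add"
  shows "(\<Sum>i = 0..<L. g ((i + 1) mod L)) = (\<Sum>i = 0..<L. g i)"
proof (cases L)
  case (Suc K)
  have "(\<Sum>i = 0..<Suc K. g ((i + 1) mod Suc K)) = (\<Sum>i = 0..<K. g (Suc i)) + g 0"
    by simp
  also have "\<dots> = (\<Sum>i = 0..<Suc K. g i)"
    by (simp add: sum.atLeast0_lessThan_Suc_shift add.commute del: sum.op_ivl_Suc)
  finally show ?thesis using Suc by simp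
qed simp

lemma number_conservingD:
  fixes L :: nat
  assumes "number_conserving q f" "L \<ge> 2" "\<And>i. i < L \<Longrightarrow> x i < q"
  shows "(\<Sum>i = 0..<L. f (x i, x ((i + 1) mod L))) = (\<Sum>i = 0..<L. x i)"
proof -
  have "x \<in> {0..<L} \<rightarrow> states q"
    using assms(3) by (auto simp: states_def)
  then show ?thesis
    using assms(1,2) unfolding number_conserving_def by blast
qed

lemma number_conserving_two:
  assumes "number_conserving q f" "a < q" "b < q"
  shows "f (a, b) + f (b, a) = a + b"
proof -
  let ?x = "\<lambda>i::nat. if i = 0 then a else b"
  have "(\<Sum>i = 0..<2. f (?x i, ?x ((i + 1) mod 2))) = (\<Sum>i = 0..<2. ?x i)"
    by (rule number_conservingD[OF assms(1)]) (use assms(2,3) in auto)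
  moreover have "{0..<2::nat} = {0, 1}" by auto
  ultimately show ?thesis by simp
qed

lemma number_conserving_three:
  assumes "number_conserving q f" "a < q" "b < q" "c < q"
  shows "f (a, b) + f (b, c) + f (c, a) = a + b + c"
proof -
  let ?x = "\<lambda>i::nat. if i = 0 then a else if i = 1 then b else c"
  have "(\<Sum>i = 0..<3. f (?x i, ?x ((i + 1) mod 3))) = (\<Sum>i = 0..<3. ?x i)"
    by (rule number_conservingD[OF assms(1)]) (use assms(2-4) in auto)
  moreover have "{0..<3::nat} = {0, 1, 2}" by auto
  ultimately show ?thesis by simp
qed

section \<open>Rules as particle flows\<close>

text \<open>Think of a state as a number of particles: a cell in state \<open>x\<close> keeps
  \<open>h x\<close> of them and receives the \<open>y - h y\<close> that its right neighbour gives
  away. Restricting makes the result extensional, as \<open>rules2\<close> demands.\<close>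

definition flow_rule :: "nat \<Rightarrow> (nat \<Rightarrow> nat) \<Rightarrow> nat \<times> nat \<Rightarrow> nat" where
  "flow_rule q h = restrict (\<lambda>(x, y). h x + (y - h y)) (states q \<times> states q)"

definition flow :: "nat \<Rightarrow> (nat \<times> nat \<Rightarrow> nat) \<Rightarrow> nat \<Rightarrow> nat" where
  "flow q f = restrict (\<lambda>x. f (x, 0)) (states q)"

text \<open>A product of intervals, so that its cardinality is a product. Truncated subtraction
  makes the lower bound \<open>0\<close> as long as \<open>y \<le> q - 1 - m\<close>.\<close>

definition flows :: "nat \<Rightarrow> nat \<Rightarrow> (nat \<Rightarrow> nat) set" where
  "flows q m = (\<Pi>\<^sub>E y \<in> states q. {y - (q - 1 - m)..min y m})"

lemma flowsD:
  assumes "h \<in> flows q m" "y < q"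
  shows "h y \<le> y" "h y \<le> m" "y - (q - 1 - m) \<le> h y"
  using assms by (auto simp: flows_def states_def PiE_iff)

text \<open>At \<open>y = q - 1\<close> the interval shrinks to the single point \<open>m\<close>.
  Hence the sets \<open>flows q m\<close> for different \<open>m < q\<close> are disjoint.\<close>

lemma flows_last:
  assumes "h \<in> flows q m" "m < q"
  shows "h (q - 1) = m"
  using flowsD[OF assms(1), of "q - 1"] assms(2) by simp

lemma number_conserving_flow_rule:
  assumes "\<And>y. y < q \<Longrightarrow> h y \<le> y"
  shows "number_conserving q (flow_rule q h)"
  unfolding number_conserving_def
proof (intro allI impI ballI)
  fix L :: nat and x assume "L \<ge> 2" and x: "x \<in> {0..<L} \<rightarrow> states q"
  have xq: "x i < q" if "i < L" for i
    using x that by (auto simp: states_def)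
  have "(\<Sum>i = 0..<L. flow_rule q h (x i, x ((i + 1) mod L)))
      = (\<Sum>i = 0..<L. h (x i) + (x ((i + 1) mod L) - h (x ((i + 1) mod L))))"
    using xq \<open>L \<ge> 2\<close> by (intro sum.cong) (auto simp: flow_rule_def states_def)
  also have "\<dots> = (\<Sum>i = 0..<L. h (x i)) + (\<Sum>i = 0..<L. x i - h (x i))"
    using sum_cyclic_shift[of "\<lambda>i. x i - h (x i)" L] by (simp add: sum.distrib)
  also have "\<dots> = (\<Sum>i = 0..<L. x i)"
    unfolding sum.distrib[symmetric] using assms xq by (intro sum.cong) auto
  finally show "(\<Sum>i = 0..<L. flow_rule q h (x i, x ((i + 1) mod L))) = (\<Sum>i = 0..<L. x i)" .
qed

text \<open>The bounds in \<open>flows\<close> give \<open>h x \<le> m\<close> and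
  \<open>y - h y \<le> q - 1 - m\<close>, and these add up to at most \<open>q - 1\<close>.\<close>

lemma flow_rule_in_rules2:
  assumes "h \<in> flows q m" "m < q"
  shows "flow_rule q h \<in> rules2 q"
proof -
  have "h x + (y - h y) < q" if "x < q" "y < q" for x y
    using flowsD[OF assms(1) that(1)] flowsD[OF assms(1) that(2)] assms(2) that by linarith
  then show ?thesis
    by (auto simp: rules2_def flow_rule_def states_def)
qed

lemma flow_flow_rule:
  assumes "h \<in> flows q m" "m < q"
  shows "flow q (flow_rule q h) = h"
proof
  fix x
  show "flow q (flow_rule q h) x = h x"
    using assms flowsD(1)[OF assms(1), of 0]
    by (auto simp: flow_def flow_rule_def states_def flows_def PiE_iff extensional_def)
qed

text \<open>Subtract conservation on the cycle \<open>x, 0\<close> from conservation on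
  \<open>x, y, 0\<close>: the term \<open>f (0, x)\<close> cancels. The cycle \<open>y, 0\<close>
  bounds \<open>f (y, 0)\<close>.\<close>

lemma flow_rule_eqs:
  assumes f: "f \<in> rules2 q" "number_conserving q f" and "x < q" "y < q"
  shows "f (x, y) + f (y, 0) = f (x, 0) + y" "f (y, 0) \<le> y" "f (x, y) < q"
proof -
  have "0 < q" using assms(3) by simp
  show "f (x, y) + f (y, 0) = f (x, 0) + y" "f (y, 0) \<le> y"
    using number_conserving_three[OF f(2) assms(3,4) \<open>0 < q\<close>]
      number_conserving_two[OF f(2) assms(3) \<open>0 < q\<close>]
      number_conserving_two[OF f(2) assms(4) \<open>0 < q\<close>] by linarith+
  show "f (x, y) < q"
    using f(1) assms(3,4) by (auto simp: rules2_def states_def PiE_iff)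
qed

lemma flow_rule_flow:
  assumes "f \<in> rules2 q" "number_conserving q f"
  shows "flow_rule q (flow q f) = f"
proof
  fix z :: "nat \<times> nat"
  obtain x y where z: "z = (x, y)" by fastforce
  show "flow_rule q (flow q f) z = f z"
  proof (cases "x < q \<and> y < q")
    case True
    then show ?thesis
      using flow_rule_eqs[OF assms, of x y] by (simp add: z flow_rule_def flow_def states_def)
  next
    case False
    then show ?thesis
      using assms(1) by (auto simp: z flow_rule_def states_def rules2_def PiE_iff extensional_def)
  qed
qed

text \<open>Pairing \<open>y\<close> with the largest state gives both bounds:
  \<open>f (q - 1, y) < q\<close> yields the lower one, and \<open>f (y, q - 1) < q\<close> yields
  \<open>f (y, 0) \<le> f (q - 1, 0)\<close>.\<close>

lemma flow_in_flows:
  assumes f: "f \<in> rules2 q" "number_conserving q f" and "q > 0"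
  shows "flow q f \<in> flows q (f (q - 1, 0))"
proof -
  have "y - (q - 1 - f (q - 1, 0)) \<le> f (y, 0) \<and> f (y, 0) \<le> y \<and> f (y, 0) \<le> f (q - 1, 0)"
    if y: "y < q" for y
  proof -
    have "q - 1 < q" using \<open>q > 0\<close> by simp
    have "y + f (q - 1, 0) \<le> f (y, 0) + (q - 1)"
      using flow_rule_eqs(1,3)[OF f \<open>q - 1 < q\<close> y] by linarith
    moreover have "f (y, 0) \<le> f (q - 1, 0)"
      using flow_rule_eqs(1,3)[OF f y \<open>q - 1 < q\<close>] by linarith
    ultimately show ?thesis
      using flow_rule_eqs(2)[OF f y y] by simp
  qed
  then show ?thesis
    by (auto simp: flows_def flow_def states_def)
qed

lemma Lambda2_eq_sum_card_flows:
  assumes "q > 0"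
  shows "Lambda2 q = (\<Sum>m<q. card (flows q m))"
proof -
  have "bij_betw (flow_rule q) (\<Union>m<q. flows q m) {f \<in> rules2 q. number_conserving q f}"
  proof (rule bij_betw_byWitness[where f' = "flow q"])
    show "flow q ` {f \<in> rules2 q. number_conserving q f} \<subseteq> (\<Union>m<q. flows q m)"
    proof clarify
      fix f assume f: "f \<in> rules2 q" "number_conserving q f"
      have "f (q - 1, 0) < q"
        using flow_rule_eqs(3)[OF f, of "q - 1" 0] assms by simp
      then show "flow q f \<in> (\<Union>m<q. flows q m)"
        using flow_in_flows[OF f assms] by blast
    qed
    show "flow_rule q ` (\<Union>m<q. flows q m) \<subseteq> {f \<in> rules2 q. number_conserving q f}"
      using flow_rule_in_rules2 number_conserving_flow_rule flowsD(1) by blast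
  qed (auto simp: flow_flow_rule flow_rule_flow)
  then have "Lambda2 q = card (\<Union>m<q. flows q m)"
    by (simp add: Lambda2_def bij_betw_same_card)
  also have "\<dots> = (\<Sum>m<q. card (flows q m))"
  proof (rule card_UN_disjoint)
    show "\<forall>m\<in>{..<q}. finite (flows q m)"
      by (auto simp: flows_def states_def intro!: finite_PiE)
    show "\<forall>m\<in>{..<q}. \<forall>m'\<in>{..<q}. m \<noteq> m' \<longrightarrow> flows q m \<inter> flows q m' = {}"
      using flows_last by (metis disjoint_iff lessThan_iff)
  qed simp
  finally show ?thesis .
qed

section \<open>The number of flows for a fixed \<open>m\<close>\<close>

lemma prod_lessThan_add:
  fixes f :: "nat \<Rightarrow> 'a::comm_monoid_mult"
  shows "(\<Prod>y<m + n. f y) = (\<Prod>y<m. f y) * (\<Prod>y<n. f (m + y))"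
  by (induction n) (simp_all add: mult.assoc)

text \<open>The factors climb through \<open>1, ..., a\<close>, stay at \<open>Suc a\<close> for
  \<open>Suc d\<close> indices, and descend through \<open>a, ..., 1\<close>.\<close>

lemma prod_trapezoid:
  "(\<Prod>y<a + Suc d + a. Suc (min y a) - (y - (a + d))) = (fact a)\<^sup>2 * Suc a ^ Suc d"
proof -
  let ?g = "\<lambda>y. Suc (min y a) - (y - (a + d))"
  have "(\<Prod>y<a. ?g y) = (\<Prod>y<a. Suc y)"
    by (intro prod.cong) auto
  also have "\<dots> = fact a"
    by (simp add: fact_prod_Suc lessThan_atLeast0)
  finally have 1: "(\<Prod>y<a. ?g y) = fact a" .
  have 2: "(\<Prod>y<Suc d. ?g (a + y)) = Suc a ^ Suc d"
  proof -
    have "(\<Prod>y<Suc d. ?g (a + y)) = (\<Prod>y<Suc d. Suc a)"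
      by (intro prod.cong) auto
    then show ?thesis by simp
  qed
  have "(\<Prod>y<a. ?g (a + Suc d + y)) = (\<Prod>y<a. a - y)"
    by (intro prod.cong) auto
  also have "\<dots> = fact a"
    by (simp add: fact_prod_rev lessThan_atLeast0)
  finally have 3: "(\<Prod>y<a. ?g (a + Suc d + y)) = fact a" .
  show ?thesis
    by (simp only: prod_lessThan_add 1 2 3) (simp add: power2_eq_square algebra_simps)
qed

lemma card_flows_eq_prod:
  "card (flows q m) = (\<Prod>y<q. Suc (min y m) - (y - (q - 1 - m)))"
  by (simp add: flows_def states_def card_PiE lessThan_atLeast0)

lemma card_flows:
  assumes "2 * a < q"
  shows "card (flows q a) = (fact a)\<^sup>2 * Suc a ^ (q - 2 * a)"
proof -
  define d where "d = q - 2 * a - 1"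
  have "q = a + Suc d + a" and *: "q - 1 - a = a + d" "q - 2 * a = Suc d"
    using assms by (auto simp: d_def)
  then have "card (flows q a) = (\<Prod>y<a + Suc d + a. Suc (min y a) - (y - (a + d)))"
    unfolding card_flows_eq_prod * by simp
  then show ?thesis
    by (simp only: prod_trapezoid *)
qed

text \<open>Replacing \<open>h y\<close> by \<open>y - h y\<close> exchanges kept and moved
  particles and maps the interval for \<open>m\<close> onto that for \<open>q - 1 - m\<close>, so
  the products agree factor by factor.\<close>

lemma card_flows_rev:
  assumes "m < q"
  shows "card (flows q (q - 1 - m)) = card (flows q m)"
  unfolding card_flows_eq_prod
proof (rule prod.cong[OF refl])
  fix y assume "y \<in> {..<q}"
  then show "Suc (min y (q - 1 - m)) - (y - (q - 1 - (q - 1 - m)))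
      = Suc (min y m) - (y - (q - 1 - m))"
    using assms by (auto simp: min_def)
qed

section \<open>Summation over \<open>m\<close>\<close>

text \<open>With \<open>j = Suc m\<close>, two of the \<open>q - 2 * m\<close> factors
  \<open>Suc m\<close> are absorbed into the squared factorial.\<close>

lemma sum_card_flows_below:
  assumes "2 * p \<le> q"
  shows "(\<Sum>m<p. card (flows q m)) = (\<Sum>j = 1..p. (fact j)\<^sup>2 * j ^ (q - 2 * j))"
proof -
  have "card (flows q m) = (fact (Suc m))\<^sup>2 * Suc m ^ (q - 2 * Suc m)" if "m < p" for m
  proof -
    \<comment> \<open>Since \<open>Suc m \<le> p\<close> and \<open>2 * p \<le> q\<close>, the
      subtraction on the right is not truncated.\<close>
    have "q - 2 * m = Suc (Suc (q - 2 * Suc m))" using that assms by simp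
    then have "card (flows q m) = (fact m)\<^sup>2 * Suc m ^ Suc (Suc (q - 2 * Suc m))"
      using card_flows[of m q] that assms by simp
    then show ?thesis
      by (simp add: power2_eq_square algebra_simps del: mult_Suc mult_Suc_right)
  qed
  then have "(\<Sum>m<p. card (flows q m)) = (\<Sum>m<p. (fact (Suc m))\<^sup>2 * Suc m ^ (q - 2 * Suc m))"
    by simp
  also have "\<dots> = (\<Sum>j = 1..p. (fact j)\<^sup>2 * j ^ (q - 2 * j))"
    by (rule sum.reindex_bij_witness[where i = "\<lambda>j. j - 1" and j = Suc]) auto
  finally show ?thesis .
qed

lemma sum_card_flows_above:
  assumes "p \<le> q"
  shows "(\<Sum>m = q - p..<q. card (flows q m)) = (\<Sum>m<p. card (flows q m))"
proof (rule sum.reindex_bij_witness[where i = "\<lambda>m. q - 1 - m" and j = "\<lambda>m. q - 1 - m"])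
  show "card (flows q (q - 1 - m)) = card (flows q m)" if "m \<in> {q - p..<q}" for m
    using card_flows_rev[of m q] that by simp
qed (use assms in auto)

theorem theorem2:
  fixes q :: nat
  assumes "q > 0"
  shows "Lambda2 q =
    (if even q
     then 2 * (\<Sum>j = 1..q div 2. (fact j)\<^sup>2 * j ^ (q - 2 * j))
     else 2 * (\<Sum>j = 1..(q - 1) div 2. (fact j)\<^sup>2 * j ^ (q - 2 * j))
          + fact ((q + 1) div 2) * fact ((q - 1) div 2))"
proof (cases "even q")
  case True
  define p where "p = q div 2"
  have q: "q = 2 * p" using True by (simp add: p_def)
  have "(\<Sum>m<q. card (flows q m))
      = (\<Sum>m<p. card (flows q m)) + (\<Sum>m = q - p..<q. card (flows q m))"
    unfolding lessThan_atLeast0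
    using sum.atLeastLessThan_concat[of 0 p q "\<lambda>m. card (flows q m)"] q by simp
  also have "\<dots> = 2 * (\<Sum>j = 1..p. (fact j)\<^sup>2 * j ^ (q - 2 * j))"
    using sum_card_flows_above[of p q] sum_card_flows_below[of p q] q by simp
  finally show ?thesis
    using True by (simp only: Lambda2_eq_sum_card_flows[OF assms] p_def if_True)
next
  case False
  define p where "p = q div 2"
  have q: "q = Suc (2 * p)" using False by (simp add: p_def)
  \<comment> \<open>Here \<open>q - p = Suc p\<close>; the middle index \<open>m = p\<close> is its
    own mirror image under \<open>m\<close> to \<open>q - 1 - m\<close> and is counted once.\<close>
  have "(\<Sum>m<q. card (flows q m))
      = (\<Sum>m<Suc p. card (flows q m)) + (\<Sum>m = q - p..<q. card (flows q m))"
    unfolding lessThan_atLeast0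
    using sum.atLeastLessThan_concat[of 0 "Suc p" q "\<lambda>m. card (flows q m)"] q by simp
  also have "\<dots> = 2 * (\<Sum>j = 1..p. (fact j)\<^sup>2 * j ^ (q - 2 * j)) + card (flows q p)"
    using sum_card_flows_above[of p q] sum_card_flows_below[of p q] q by simp
  \<comment> \<open>As \<open>q - 2 * p = 1\<close>, the plateau is a single factor
    \<open>Suc p\<close>, which turns one \<open>fact p\<close> into
    \<open>fact (Suc p)\<close>.\<close>
  also have "card (flows q p) = fact (Suc p) * fact p"
    using card_flows[of p q] q by (simp add: power2_eq_square algebra_simps)
  finally have "Lambda2 q = 2 * (\<Sum>j = 1..p. (fact j)\<^sup>2 * j ^ (q - 2 * j)) + fact (Suc p) * fact p"
    by (simp only: Lambda2_eq_sum_card_flows[OF assms])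
  moreover have "(q - 1) div 2 = p" "(q + 1) div 2 = Suc p"
    using q by auto
  ultimately show ?thesis
    using False by (simp only: if_False)
qed

end
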